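(* Let $Y\subseteq H$ be a closed bounded convex set, let $\rho>0$ and let $f:B_{\rho}\to H$ be a $C^1$ function whose derivative is Lipschitzian with constant $\gamma$. Moreover, let $\eta$ be the Lipschitz constant of the function $x\mapsto x-f(x)$ on $B_\rho$, set $$\theta:=\sup_{x\in B_{\rho}}\|f'(x)\|_{\mathcal{L}(H)},\qquad L:=2\left(\eta+\theta+\gamma\left(\rho+\sup_{y\in Y}\|y\|\right)\right)$$ and assume that $$\sigma:=\inf_{y\in Y}\sup_{\|u\|=1}|\langle f'(0)(u),y\rangle-\langle f(0),u\rangle|>0.$$ Then, for each $r\in\left]0,\min\left\{\rho,\frac{\sigma}{L}\right\}\right]$ and for each non-empty closed convex set $T\subseteq Y$, there exist $x^*\in S_r$ and $y^*\in T$ such that $$\|x^*-f(x^* )\|^2+\|f(x)-y^*\|^2-\|x-f(x)\|^2<\|f(x^* )-y^*\|^2=(\mathrm{dist}(f(x^* ),T))^2$$ for all $x\in B_r\setminus\{x^*\}$.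
   Context: $(H,\langle\cdot,\cdot\rangle)$ is a real Hilbert space. For each $r>0$, $B_r=\{x\in H:\|x\|\leq r\}$ and $S_r=\{x\in H:\|x\|=r\}$. $\mathcal{L}(H)$ is the space of bounded linear operators from $H$ to $H$ with the operator norm $\|\cdot\|_{\mathcal{L}(H)}$, and $f'(x)\in\mathcal{L}(H)$ is the Fréchet derivative of $f$ at $x$. For $z\in H$ and non-empty $T\subseteq H$, $\mathrm{dist}(z,T)=\inf_{y\in T}\|z-y\|$. $]a,b]$ denotes the half-open interval $\{t: a<t\leq b\}$. *)

theory Defs
  imports "HOL-Analysis.Analysis"
begin

text \<open>The least Lipschitz constant; meaningful only if \<open>g\<close> is Lipschitz on \<open>S\<close>.\<close>

definition lipschitz_constant :: "('a::metric_space \<Rightarrow> 'b::metric_space) \<Rightarrow> 'a set \<Rightarrow> real"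
  where "lipschitz_constant g S = Inf {C. C-lipschitz_on S g}"

end

theory Submission
  imports Defs
begin

text \<open>
  Write \<open>J y x = (norm (f x - y))\<^sup>2 - (norm (x - f x))\<^sup>2\<close>. The claim is that \<open>J\<close> has a saddle
  point on \<open>cball 0 r \<times> T\<close>: a point \<open>x\<^sub>0\<close> that is the strict maximum of \<open>J y\<^sub>0\<close> on the ball and lies
  on the sphere, and a point \<open>y\<^sub>0\<close> that minimizes \<open>\<lambda>y. J y x\<^sub>0\<close> on \<open>T\<close>, which means that \<open>y\<^sub>0\<close> is the
  point of \<open>T\<close> nearest to \<open>f x\<^sub>0\<close>.

  For fixed \<open>y\<close>, expanding the squares gives
  \<open>J y x = 2 * (f x \<bullet> (x - y)) - (norm x)\<^sup>2 + (norm y)\<^sup>2\<close>. Its derivative is Lipschitz with constant \<open>L\<close>,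
  and at \<open>0\<close> it has norm at least \<open>2 * \<sigma>\<close>, hence at least \<open>2 * L * r\<close>. For such a steep
  function \<open>\<phi>\<close>, two estimates are combined: at the midpoint \<open>m\<close> of two points of the ball, \<open>\<phi>\<close> is
  smaller than the smaller of the two values by at most \<open>L / 2 * (r\<^sup>2 - (norm m)\<^sup>2)\<close>; and a step of
  length \<open>r - norm m\<close> from \<open>m\<close> in a direction of nearly steepest ascent gains more than that, the
  surplus being \<open>L * (r - norm m)\<^sup>2\<close> (\<open>steep_midpoint_gain\<close>). So if both points are nearly maximal, their
  midpoint is close to the sphere and, by the parallelogram law, the points are close to each other.
  Every maximizing sequence is therefore Cauchy, which replaces compactness: the maximum is
  attained, unique, stable, and located on the sphere. The argument covers the extreme radius
  \<open>r = \<sigma> / L\<close>.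

  The saddle point then follows in \<open>well_posed_saddle_point\<close>. The function \<open>H y = Max (J y)\<close> is strongly
  convex and continuous in \<open>y\<close>, so it attains its minimum over \<open>T\<close> at some \<open>y\<^sub>0\<close>. Moving from \<open>y\<^sub>0\<close>
  slightly towards another point of \<open>T\<close> moves the maximizer only slightly, and the minimality of
  \<open>H y\<^sub>0\<close> becomes, in the limit, the variational inequality that characterizes \<open>y\<^sub>0\<close> as the
  projection of \<open>f x\<^sub>0\<close> onto \<open>T\<close>.
\<close>

section \<open>Well-posed maximization\<close>

text \<open>
  Tykhonov well-posedness of the problem of maximizing \<open>\<phi>\<close> over \<open>K\<close>: the diameter of the set of
  \<open>d\<close>-approximate maximizers tends to \<open>0\<close> with \<open>d\<close>. Approximate maximality is expressed by comparison
  with every value of \<open>\<phi>\<close> on \<open>K\<close>, so that no supremum has to exist.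
\<close>

definition well_posed_max :: "('b::metric_space \<Rightarrow> real) \<Rightarrow> 'b set \<Rightarrow> bool"
  where "well_posed_max \<phi> K \<longleftrightarrow> (\<forall>e>0. \<exists>d>0. \<forall>x\<in>K. \<forall>x'\<in>K.
    (\<forall>z\<in>K. \<phi> z \<le> \<phi> x + d \<and> \<phi> z \<le> \<phi> x' + d) \<longrightarrow> dist x x' < e)"

lemma well_posed_maxD:
  assumes "well_posed_max \<phi> K" "e > 0"
  obtains d where "d > 0"
    "\<And>x x'. x \<in> K \<Longrightarrow> x' \<in> K \<Longrightarrow> (\<And>z. z \<in> K \<Longrightarrow> \<phi> z \<le> \<phi> x + d) \<Longrightarrow>
      (\<And>z. z \<in> K \<Longrightarrow> \<phi> z \<le> \<phi> x' + d) \<Longrightarrow> dist x x' < e"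
  using assms unfolding well_posed_max_def by meson

lemma well_posed_max_attained:
  fixes \<phi> :: "'b::metric_space \<Rightarrow> real"
  assumes "complete K" "K \<noteq> {}" and cont: "continuous_on K \<phi>" and bdd: "bdd_above (\<phi> ` K)"
    and wp: "well_posed_max \<phi> K"
  obtains x where "x \<in> K" "\<And>z. z \<in> K \<Longrightarrow> \<phi> z \<le> \<phi> x"
proof -
  define S where "S = (SUP x\<in>K. \<phi> x)"
  have S: "\<phi> z \<le> S" if "z \<in> K" for z
    unfolding S_def using that bdd by (rule cSUP_upper)
  have "\<exists>x\<in>K. S - inverse (real (Suc n)) < \<phi> x" for n
  proof -
    have "S - inverse (real (Suc n)) < (SUP x\<in>K. \<phi> x)"
      unfolding S_def by simp
    then show ?thesis
      using less_cSUP_iff[OF \<open>K \<noteq> {}\<close> bdd] by blast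
  qed
  then obtain X where XK: "\<And>n. X n \<in> K" and X: "\<And>n. S - inverse (real (Suc n)) < \<phi> (X n)"
    by metis
  have near: "\<phi> z \<le> \<phi> (X n) + inverse (real (Suc n))" if "z \<in> K" for z n
    using S[OF that] X[of n] by linarith
  have "Cauchy X"
  proof (rule metric_CauchyI)
    fix e :: real assume "e > 0"
    with wp obtain d where "d > 0" and d: "\<And>x x'. x \<in> K \<Longrightarrow> x' \<in> K \<Longrightarrow>
        (\<And>z. z \<in> K \<Longrightarrow> \<phi> z \<le> \<phi> x + d) \<Longrightarrow> (\<And>z. z \<in> K \<Longrightarrow> \<phi> z \<le> \<phi> x' + d) \<Longrightarrow> dist x x' < e"
      by (rule well_posed_maxD) blast
    obtain N where N: "inverse (real (Suc N)) < d"
      using reals_Archimedean[OF \<open>d > 0\<close>] by blast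
    have "\<phi> z \<le> \<phi> (X n) + d" if "n \<ge> N" "z \<in> K" for n z
    proof -
      have "inverse (real (Suc n)) \<le> inverse (real (Suc N))"
        using that by (intro le_imp_inverse_le) auto
      then show ?thesis using near[OF \<open>z \<in> K\<close>, of n] N by linarith
    qed
    then show "\<exists>N. \<forall>m\<ge>N. \<forall>n\<ge>N. dist (X m) (X n) < e"
      using d XK by meson
  qed
  then obtain l where l: "l \<in> K" "X \<longlonglongrightarrow> l"
    using \<open>complete K\<close> XK unfolding complete_def by meson
  have "(\<lambda>n. \<phi> (X n)) \<longlonglongrightarrow> \<phi> l"
    using continuous_on_tendsto_compose[OF cont l(2) l(1)] XK by simp
  from tendsto_add[OF this LIMSEQ_inverse_real_of_nat]
  have lim: "(\<lambda>n. \<phi> (X n) + inverse (real (Suc n))) \<longlonglongrightarrow> \<phi> l" by simp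
  have "\<phi> z \<le> \<phi> l" if "z \<in> K" for z
    using LIMSEQ_le_const[OF lim] near[OF that] by blast
  with l(1) show thesis by (rule that)
qed

lemma well_posed_max_strict:
  assumes wp: "well_posed_max \<phi> K" and x: "x \<in> K" "\<And>z. z \<in> K \<Longrightarrow> \<phi> z \<le> \<phi> x"
    and w: "w \<in> K" "w \<noteq> x"
  shows "\<phi> w < \<phi> x"
proof (rule ccontr)
  assume "\<not> \<phi> w < \<phi> x"
  then have *: "\<phi> z \<le> \<phi> w" if "z \<in> K" for z using x(2)[OF that] by linarith
  obtain d where "d > 0" and d: "\<And>a b. a \<in> K \<Longrightarrow> b \<in> K \<Longrightarrow> (\<And>z. z \<in> K \<Longrightarrow> \<phi> z \<le> \<phi> a + d) \<Longrightarrow>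
      (\<And>z. z \<in> K \<Longrightarrow> \<phi> z \<le> \<phi> b + d) \<Longrightarrow> dist a b < dist w x"
    using well_posed_maxD[OF wp, of "dist w x"] w(2) by (metis zero_less_dist_iff)
  have "\<phi> z \<le> \<phi> w + d" "\<phi> z \<le> \<phi> x + d" if "z \<in> K" for z
    using *[OF that] x(2)[OF that] \<open>d > 0\<close> by linarith+
  then have "dist w x < dist w x"
    by (rule d[OF w(1) x(1)])
  then show False by simp
qed

lemma well_posed_max_convergent:
  assumes wp: "well_posed_max \<phi> K" and x: "x \<in> K" "\<And>z. z \<in> K \<Longrightarrow> \<phi> z \<le> \<phi> x"
    and X: "\<And>n. X n \<in> K" and lim: "(\<lambda>n. \<phi> (X n)) \<longlonglongrightarrow> \<phi> x"
  shows "X \<longlonglongrightarrow> x"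
proof (rule tendstoI)
  fix e :: real assume "e > 0"
  with wp obtain d where "d > 0" and d: "\<And>x x'. x \<in> K \<Longrightarrow> x' \<in> K \<Longrightarrow>
        (\<And>z. z \<in> K \<Longrightarrow> \<phi> z \<le> \<phi> x + d) \<Longrightarrow> (\<And>z. z \<in> K \<Longrightarrow> \<phi> z \<le> \<phi> x' + d) \<Longrightarrow> dist x x' < e"
    by (rule well_posed_maxD) blast
  have "\<forall>\<^sub>F n in sequentially. \<phi> x - d < \<phi> (X n)"
    using order_tendstoD(1)[OF lim, of "\<phi> x - d"] \<open>d > 0\<close> by simp
  then show "\<forall>\<^sub>F n in sequentially. dist (X n) x < e"
  proof eventually_elim
    case (elim n)
    have "\<phi> z \<le> \<phi> (X n) + d" "\<phi> z \<le> \<phi> x + d" if "z \<in> K" for z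
      using x(2)[OF that] elim \<open>d > 0\<close> by linarith+
    then show ?case
      by (rule d[OF X x(1)])
  qed
qed


section \<open>Steep functions with Lipschitz derivative on a ball\<close>

lemma quadratic_upper_bound:
  fixes \<phi> :: "'a::real_normed_vector \<Rightarrow> real"
  assumes "convex C"
    and der: "\<And>x. x \<in> C \<Longrightarrow> (\<phi> has_derivative D x) (at x within C)"
    and lip: "\<And>x y h. x \<in> C \<Longrightarrow> y \<in> C \<Longrightarrow> \<bar>D x h - D y h\<bar> \<le> M * norm (x - y) * norm h"
    and x: "x \<in> C" "x + h \<in> C"
  shows "\<phi> (x + h) \<le> \<phi> x + D x h + M / 2 * (norm h)\<^sup>2"
proof -
  define q where "q t = \<phi> (x + t *\<^sub>R h) - t * D x h - M / 2 * (norm h)\<^sup>2 * t\<^sup>2" for t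
  have seg: "x + t *\<^sub>R h \<in> C" if "t \<in> {0..1}" for t
    using convexD_alt[OF \<open>convex C\<close> x, of t] that by (simp add: algebra_simps)
  have dq: "(q has_derivative
      (\<lambda>s. D (x + t *\<^sub>R h) (s *\<^sub>R h) - s * D x h - M * (norm h)\<^sup>2 * t * s)) (at t within {0..1})"
    if "t \<in> {0..1}" for t
  proof -
    have "((\<lambda>t. \<phi> (x + t *\<^sub>R h)) has_derivative (\<lambda>s. D (x + t *\<^sub>R h) (s *\<^sub>R h))) (at t within {0..1})"
      by (rule has_derivative_in_compose2[where t = C and g = \<phi>, OF der])
         (use that seg in \<open>auto intro!: derivative_eq_intros\<close>)
    then show ?thesis
      unfolding q_def by (auto intro!: derivative_eq_intros simp: field_simps)
  qed
  obtain t where t: "t \<in> {0<..<1}"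
    and "q 1 - q 0 = D (x + t *\<^sub>R h) ((1 - 0) *\<^sub>R h) - (1 - 0) * D x h - M * (norm h)\<^sup>2 * t * (1 - 0)"
    using mvt_simple[of 0 1 q, OF _ dq] by force
  moreover have "D (x + t *\<^sub>R h) h - D x h \<le> M * (norm h)\<^sup>2 * t"
    using lip[of "x + t *\<^sub>R h" x h] seg[of t] x(1) t by (simp add: power2_eq_square algebra_simps)
  ultimately have "q 1 \<le> q 0" by simp
  then show ?thesis by (simp add: q_def)
qed

lemma quadratic_lower_bound:
  fixes \<phi> :: "'a::real_normed_vector \<Rightarrow> real"
  assumes "convex C"
    and der: "\<And>x. x \<in> C \<Longrightarrow> (\<phi> has_derivative D x) (at x within C)"
    and lip: "\<And>x y h. x \<in> C \<Longrightarrow> y \<in> C \<Longrightarrow> \<bar>D x h - D y h\<bar> \<le> M * norm (x - y) * norm h"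
    and x: "x \<in> C" "x + h \<in> C"
  shows "\<phi> x + D x h - M / 2 * (norm h)\<^sup>2 \<le> \<phi> (x + h)"
proof -
  have "- \<phi> (x + h) \<le> - \<phi> x + - D x h + M / 2 * (norm h)\<^sup>2"
  proof (rule quadratic_upper_bound[OF \<open>convex C\<close> _ _ x, where D = "\<lambda>x h. - D x h"])
    show "((\<lambda>x. - \<phi> x) has_derivative (\<lambda>h. - D x h)) (at x within C)" if "x \<in> C" for x
      using der[OF that] by (rule has_derivative_minus)
    show "\<bar>- D x h - - D y h\<bar> \<le> M * norm (x - y) * norm h" if "x \<in> C" "y \<in> C" for x y h
      using lip[OF that, of h] by linarith
  qed
  then show ?thesis by linarith
qed

text \<open>
  The derivative of \<open>\<phi>\<close> at the centre has norm at least \<open>2 * M * r\<close>; since that norm need not be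
  attained, steepness is stated with an arbitrarily small loss \<open>e\<close>. If \<open>m\<close> is the midpoint of \<open>a\<close> and
  \<open>b\<close>, the derivative at \<open>m\<close> still has norm at least \<open>2 * M * r - M * norm m\<close>. A step of length
  \<open>r - norm m\<close> from \<open>m\<close> stays in the ball and gains, up to \<open>e\<close>, at least
  \<open>M / 2 * (r - norm m) * (3 * r - norm m)\<close>, whereas \<open>\<phi> m\<close> lies below \<open>min (\<phi> a) (\<phi> b)\<close> by at most
  \<open>M / 2 * (r - norm m) * (r + norm m)\<close>.
\<close>

lemma steep_midpoint_gain:
  fixes \<phi> :: "'a::real_inner \<Rightarrow> real"
  assumes der: "\<And>x. x \<in> cball 0 r \<Longrightarrow> (\<phi> has_derivative D x) (at x within cball 0 r)"
    and lip: "\<And>x y h. x \<in> cball 0 r \<Longrightarrow> y \<in> cball 0 r \<Longrightarrow>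
      \<bar>D x h - D y h\<bar> \<le> M * norm (x - y) * norm h"
    and steep: "\<And>e. e > 0 \<Longrightarrow> \<exists>u. norm u = 1 \<and> 2 * M * r - e < D 0 u"
    and "M > 0" "r > 0"
    and S: "\<And>z. z \<in> cball 0 r \<Longrightarrow> \<phi> z \<le> S"
    and ab: "a \<in> cball 0 r" "b \<in> cball 0 r"
  shows "min (\<phi> a) (\<phi> b) + M * (r - norm (midpoint a b))\<^sup>2 \<le> S"
proof -
  define m where "m = midpoint a b"
  define h where "h = (1 / 2) *\<^sub>R (a - b)"
  define s where "s = r - norm m"
  have a: "a = m + h" and b: "b = m + - h"
    unfolding m_def h_def midpoint_def
    by (simp_all add: algebra_simps flip: scaleR_add_left)
  have mC: "m \<in> cball 0 r"
    using convexD_alt[OF convex_cball ab, of "1/2"] by (simp add: m_def midpoint_def algebra_simps)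
  have s0: "s \<ge> 0" using mC by (simp add: s_def)
  have neg: "D m (- h) = - D m h"
    using linear_neg[OF has_derivative_linear[OF der[OF mC]]] .
  have up: "\<phi> a \<le> \<phi> m + D m h + M / 2 * (norm h)\<^sup>2"
    using quadratic_upper_bound[OF convex_cball der lip mC, of h] ab a by simp
  have un: "\<phi> b \<le> \<phi> m - D m h + M / 2 * (norm h)\<^sup>2"
    using quadratic_upper_bound[OF convex_cball der lip mC, of "- h"] ab b neg by simp
  have par: "2 * (norm m)\<^sup>2 + 2 * (norm h)\<^sup>2 = (norm a)\<^sup>2 + (norm b)\<^sup>2"
    unfolding a b by (simp add: power2_norm_eq_inner algebra_simps inner_commute)
  have "(norm a)\<^sup>2 \<le> r\<^sup>2" "(norm b)\<^sup>2 \<le> r\<^sup>2"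
    using ab by (simp_all add: power_mono)
  with par have "(norm h)\<^sup>2 \<le> r\<^sup>2 - (norm m)\<^sup>2" by linarith
  then have "M / 2 * (norm h)\<^sup>2 \<le> M / 2 * (r\<^sup>2 - (norm m)\<^sup>2)"
    using \<open>M > 0\<close> by (intro mult_left_mono) auto
  with up un have mid: "min (\<phi> a) (\<phi> b) \<le> \<phi> m + M / 2 * (r\<^sup>2 - (norm m)\<^sup>2)" by linarith
  \<comment> \<open>Step of length \<open>s\<close> from the midpoint in an almost steepest direction.\<close>
  have step: "\<phi> m + s * (2 * M * r - M * norm m) - M / 2 * s\<^sup>2 \<le> S + s * e" if e: "e > 0" for e
  proof -
    obtain u where u: "norm u = 1" "2 * M * r - e < D 0 u"
      using steep[OF e] by blast
    have "\<bar>D m u - D 0 u\<bar> \<le> M * norm m"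
      using lip[of m 0 u] mC u \<open>r > 0\<close> by simp
    with u have "2 * M * r - M * norm m - e \<le> D m u" by linarith
    then have "s * (2 * M * r - M * norm m - e) \<le> s * D m u"
      using s0 by (rule mult_left_mono)
    moreover have "D m (s *\<^sub>R u) = s * D m u"
      using linear_scale[OF has_derivative_linear[OF der[OF mC]]] by simp
    moreover have "m + s *\<^sub>R u \<in> cball 0 r"
      using norm_triangle_ineq[of m "s *\<^sub>R u"] u s0 by (simp add: s_def)
    moreover from this have "\<phi> m + D m (s *\<^sub>R u) - M / 2 * s\<^sup>2 \<le> \<phi> (m + s *\<^sub>R u)"
      using quadratic_lower_bound[OF convex_cball der lip mC, of "s *\<^sub>R u"] u by simp
    ultimately show ?thesis
      using S[of "m + s *\<^sub>R u"] by (simp add: algebra_simps)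
  qed
  have "\<phi> m + s * (2 * M * r - M * norm m) - M / 2 * s\<^sup>2 \<le> S"
  proof (rule field_le_epsilon)
    fix e :: real assume "e > 0"
    have "s * (e / (s + 1)) \<le> e"
      using s0 \<open>e > 0\<close> by (simp add: field_simps)
    with step[of "e / (s + 1)"] \<open>e > 0\<close> s0
    show "\<phi> m + s * (2 * M * r - M * norm m) - M / 2 * s\<^sup>2 \<le> S + e" by simp
  qed
  moreover have "s * (2 * M * r - M * norm m) - M / 2 * s\<^sup>2
      = M / 2 * (r\<^sup>2 - (norm m)\<^sup>2) + M * (r - norm m)\<^sup>2"
    unfolding s_def by (simp add: power2_eq_square field_simps)
  ultimately show ?thesis using mid unfolding m_def by linarith
qed

lemma steep_well_posed_max:
  fixes \<phi> :: "'a::real_inner \<Rightarrow> real"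
  assumes der: "\<And>x. x \<in> cball 0 r \<Longrightarrow> (\<phi> has_derivative D x) (at x within cball 0 r)"
    and lip: "\<And>x y h. x \<in> cball 0 r \<Longrightarrow> y \<in> cball 0 r \<Longrightarrow>
      \<bar>D x h - D y h\<bar> \<le> M * norm (x - y) * norm h"
    and steep: "\<And>e. e > 0 \<Longrightarrow> \<exists>u. norm u = 1 \<and> 2 * M * r - e < D 0 u"
    and "M > 0" "r > 0"
  shows "well_posed_max \<phi> (cball 0 r)"
  unfolding well_posed_max_def
proof (intro allI impI)
  fix e :: real assume "e > 0"
  \<comment> \<open>Tolerance \<open>q\<close> for \<open>r - norm m\<close>: the parallelogram law turns it into \<open>(norm (a - b))\<^sup>2 \<le> 8 * r * q\<close>.\<close>
  define q where "q = e\<^sup>2 / (16 * r)"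
  have "q > 0" using \<open>e > 0\<close> \<open>r > 0\<close> by (simp add: q_def)
  have "dist a b < e" if ab: "a \<in> cball 0 r" "b \<in> cball 0 r"
    and near: "\<forall>z\<in>cball 0 r. \<phi> z \<le> \<phi> a + M * q\<^sup>2 \<and> \<phi> z \<le> \<phi> b + M * q\<^sup>2" for a b
  proof -
    define m where "m = midpoint a b"
    have "min (\<phi> a) (\<phi> b) + M * (r - norm m)\<^sup>2 \<le> min (\<phi> a) (\<phi> b) + M * q\<^sup>2"
      unfolding m_def
      by (rule steep_midpoint_gain[OF der lip steep \<open>M > 0\<close> \<open>r > 0\<close> _ ab]) (use near in \<open>auto simp: min_def\<close>)
    then have "(r - norm m)\<^sup>2 \<le> q\<^sup>2" using \<open>M > 0\<close> by simp
    then have q: "r - norm m \<le> q" using \<open>q > 0\<close> by (rule power2_le_imp_le[OF _ less_imp_le])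
    have "norm m \<le> r"
      using convexD_alt[OF convex_cball ab, of "1/2"] by (simp add: m_def midpoint_def algebra_simps)
    then have "(r - norm m) * (r + norm m) \<le> q * (2 * r)"
      using q \<open>q > 0\<close> \<open>r > 0\<close> by (intro mult_mono) auto
    moreover have "(norm a)\<^sup>2 \<le> r\<^sup>2" "(norm b)\<^sup>2 \<le> r\<^sup>2"
      using ab by (simp_all add: power_mono)
    moreover have "(norm (a - b))\<^sup>2 = 2 * (norm a)\<^sup>2 + 2 * (norm b)\<^sup>2 - 4 * (norm m)\<^sup>2"
      unfolding m_def midpoint_def
      by (simp add: power2_norm_eq_inner algebra_simps inner_commute)
    ultimately have "(norm (a - b))\<^sup>2 \<le> 8 * r * q"
      by (simp add: power2_eq_square algebra_simps)
    also have "8 * r * q = e\<^sup>2 / 2" using \<open>r > 0\<close> by (simp add: q_def)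
    also have "\<dots> < e\<^sup>2" using \<open>e > 0\<close> by simp
    finally show ?thesis
      using \<open>e > 0\<close> power2_less_imp_less[of "norm (a - b)" e] by (simp add: dist_norm)
  qed
  moreover have "M * q\<^sup>2 > 0" using \<open>M > 0\<close> \<open>q > 0\<close> by simp
  ultimately show "\<exists>d>0. \<forall>x\<in>cball 0 r. \<forall>x'\<in>cball 0 r.
      (\<forall>z\<in>cball 0 r. \<phi> z \<le> \<phi> x + d \<and> \<phi> z \<le> \<phi> x' + d) \<longrightarrow> dist x x' < e"
    by blast
qed

lemma steep_maximum_on_sphere:
  fixes \<phi> :: "'a::real_inner \<Rightarrow> real"
  assumes der: "\<And>x. x \<in> cball 0 r \<Longrightarrow> (\<phi> has_derivative D x) (at x within cball 0 r)"
    and lip: "\<And>x y h. x \<in> cball 0 r \<Longrightarrow> y \<in> cball 0 r \<Longrightarrow>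
      \<bar>D x h - D y h\<bar> \<le> M * norm (x - y) * norm h"
    and steep: "\<And>e. e > 0 \<Longrightarrow> \<exists>u. norm u = 1 \<and> 2 * M * r - e < D 0 u"
    and "M > 0" "r > 0"
    and x: "x \<in> cball 0 r" and max: "\<And>z. z \<in> cball 0 r \<Longrightarrow> \<phi> z \<le> \<phi> x"
  shows "x \<in> sphere 0 r"
proof -
  have "M * (r - norm x)\<^sup>2 \<le> 0"
    using steep_midpoint_gain[OF der lip steep \<open>M > 0\<close> \<open>r > 0\<close> max x x] by simp
  then have "(r - norm x)\<^sup>2 \<le> 0" using \<open>M > 0\<close> by (simp add: mult_le_0_iff)
  then show ?thesis by simp
qed


section \<open>Saddle points\<close>

text \<open>
  The function \<open>\<lambda>x. (norm (F x - y))\<^sup>2 - g x\<close> need not be concave, so the classical convex-concave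
  minimax theorems do not apply; well-posedness for every \<open>y\<close> takes the place of concavity.
\<close>

lemma well_posed_saddle_point:
  fixes F :: "'b::metric_space \<Rightarrow> 'a::{real_inner, complete_space}" and g :: "'b \<Rightarrow> real"
  assumes K: "complete K" "K \<noteq> {}"
    and F: "continuous_on K F" "bounded (F ` K)"
    and g: "continuous_on K g" "bounded (g ` K)"
    and T: "closed T" "convex T" "bounded T" "T \<noteq> {}"
    and wp: "\<And>y. y \<in> T \<Longrightarrow> well_posed_max (\<lambda>x. (norm (F x - y))\<^sup>2 - g x) K"
  obtains x\<^sub>0 y\<^sub>0 where "x\<^sub>0 \<in> K" "y\<^sub>0 \<in> T"
    "\<And>x. x \<in> K \<Longrightarrow> (norm (F x - y\<^sub>0))\<^sup>2 - g x \<le> (norm (F x\<^sub>0 - y\<^sub>0))\<^sup>2 - g x\<^sub>0"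
    "\<And>y. y \<in> T \<Longrightarrow> norm (F x\<^sub>0 - y\<^sub>0) \<le> norm (F x\<^sub>0 - y)"
proof -
  define J where "J y x = (norm (F x - y))\<^sup>2 - g x" for y x
  obtain A where A: "\<And>x. x \<in> K \<Longrightarrow> norm (F x) \<le> A" using F(2) unfolding bounded_iff by auto
  obtain B where B: "\<And>x. x \<in> K \<Longrightarrow> \<bar>g x\<bar> \<le> B" using g(2) unfolding bounded_iff by auto
  obtain R where R: "\<And>y. y \<in> T \<Longrightarrow> norm y \<le> R" using T(3) unfolding bounded_iff by auto
  define C where "C = 2 * (A + R)"
  have FT: "norm (F x - y) \<le> A + R" if "x \<in> K" "y \<in> T" for x y
    using norm_triangle_ineq4[of "F x" y] A[OF that(1)] R[OF that(2)] by linarith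
  have Jub: "J y x \<le> (A + R)\<^sup>2 + B" if "x \<in> K" "y \<in> T" for x y
    using power_mono[OF FT[OF that], of 2] B[OF that(1)] unfolding J_def by simp
  have Jlip: "J y x \<le> J y' x + C * norm (y - y')" if "x \<in> K" "y \<in> T" "y' \<in> T" for x y y'
  proof -
    have "norm (F x - y) - norm (F x - y') \<le> norm (y - y')"
      using norm_triangle_ineq2[of "F x - y" "F x - y'"] by (simp add: norm_minus_commute)
    then have "(norm (F x - y) - norm (F x - y')) * (norm (F x - y) + norm (F x - y'))
        \<le> norm (y - y') * (norm (F x - y) + norm (F x - y'))"
      by (intro mult_right_mono) auto
    also have "\<dots> \<le> norm (y - y') * C"
      using FT[OF that(1,2)] FT[OF that(1,3)] by (intro mult_left_mono) (auto simp: C_def)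
    finally show ?thesis by (simp add: J_def power2_eq_square algebra_simps)
  qed
  \<comment> \<open>\<open>J\<close> is strongly convex in \<open>y\<close>, with a modulus independent of \<open>x\<close>, so the maximum over \<open>x\<close> is too.\<close>
  have Jmid: "J (midpoint y y') x = J y x / 2 + J y' x / 2 - (norm (y - y'))\<^sup>2 / 4" for x y y'
  proof -
    have par: "(norm ((1 / 2) *\<^sub>R (a + b)))\<^sup>2 = (norm a)\<^sup>2 / 2 + (norm b)\<^sup>2 / 2 - (norm (a - b))\<^sup>2 / 4"
      for a b :: 'a
      unfolding power2_norm_eq_inner
      by (simp add: inner_add_left inner_add_right inner_diff_left inner_diff_right
          inner_commute[of b a] field_simps)
    have "F x - midpoint y y' = (1 / 2) *\<^sub>R ((F x - y) + (F x - y'))"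
      by (simp add: midpoint_def scaleR_add_right scaleR_diff_right flip: scaleR_add_left)
    moreover have "norm ((F x - y) - (F x - y')) = norm (y - y')"
      by (simp add: norm_minus_commute)
    ultimately show ?thesis
      using par[of "F x - y" "F x - y'"] unfolding J_def by (simp only:) argo
  qed
  have wpJ: "well_posed_max (J y) K" if "y \<in> T" for y
    using wp[OF that] unfolding J_def .
  have "\<exists>x. x \<in> K \<and> (\<forall>z\<in>K. J y z \<le> J y x)" if "y \<in> T" for y
  proof -
    have "continuous_on K (J y)" unfolding J_def by (intro continuous_intros F g)
    moreover have "bdd_above (J y ` K)" using Jub[OF _ that] by (auto intro!: bdd_aboveI2)
    ultimately show ?thesis using well_posed_max_attained[OF K _ _ wpJ[OF that]] by metis
  qed
  then obtain X where XK: "\<And>y. y \<in> T \<Longrightarrow> X y \<in> K"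
    and X: "\<And>y z. y \<in> T \<Longrightarrow> z \<in> K \<Longrightarrow> J y z \<le> J y (X y)"
    by metis
  define H where "H y = J y (X y)" for y
  have Hlip: "H y \<le> H y' + C * norm (y - y')" if "y \<in> T" "y' \<in> T" for y y'
    using Jlip[OF XK[OF that(1)] that] X[OF that(2) XK[OF that(1)]] unfolding H_def by linarith
  obtain y0 where y0: "y0 \<in> T" and "\<And>y. y \<in> T \<Longrightarrow> - H y \<le> - H y0"
  proof (rule well_posed_max_attained)
    show "complete T" "T \<noteq> {}" using T by (simp_all add: complete_eq_closed)
    have "C \<ge> 0"
    proof -
      obtain x y where "x \<in> K" "y \<in> T" using K T by blast
      then show ?thesis using order_trans[OF norm_ge_zero FT[of x y]] unfolding C_def by simp
    qed
    have "C-lipschitz_on T (\<lambda>y. - H y)"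
    proof (rule lipschitz_onI)
      fix y y' assume "y \<in> T" "y' \<in> T"
      then show "dist (- H y) (- H y') \<le> C * dist y y'"
        using Hlip[of y y'] Hlip[of y' y] by (simp add: dist_norm norm_minus_commute abs_le_iff)
    qed fact
    then show "continuous_on T (\<lambda>y. - H y)" by (rule lipschitz_on_continuous_on)
    have "- H y \<le> B" if "y \<in> T" for y
      using B[OF XK[OF that]] zero_le_power2[of "norm (F (X y) - y)"] unfolding H_def J_def by linarith
    then show "bdd_above ((\<lambda>y. - H y) ` T)" by (rule bdd_aboveI2)
    show "well_posed_max (\<lambda>y. - H y) T"
      unfolding well_posed_max_def
    proof (intro allI impI)
      fix e :: real assume "e > 0"
      have "dist y y' < e" if yT: "y \<in> T" "y' \<in> T"
        and near: "\<forall>z\<in>T. - H z \<le> - H y + e\<^sup>2 / 8 \<and> - H z \<le> - H y' + e\<^sup>2 / 8" for y y'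
      proof -
        define m where "m = midpoint y y'"
        have mT: "m \<in> T"
          using convexD_alt[OF T(2) yT, of "1/2"] by (simp add: m_def midpoint_def algebra_simps)
        have "H m = J y (X m) / 2 + J y' (X m) / 2 - (norm (y - y'))\<^sup>2 / 4"
          unfolding H_def using Jmid[of y y' "X m"] by (simp add: m_def)
        also have "\<dots> \<le> H y / 2 + H y' / 2 - (norm (y - y'))\<^sup>2 / 4"
          using X[OF yT(1) XK[OF mT]] X[OF yT(2) XK[OF mT]] unfolding H_def by linarith
        finally have "(norm (y - y'))\<^sup>2 \<le> e\<^sup>2 / 2"
          using near mT by fastforce
        also have "\<dots> < e\<^sup>2" using \<open>e > 0\<close> by simp
        finally show ?thesis
          using \<open>e > 0\<close> power2_less_imp_less[of "norm (y - y')" e] by (simp add: dist_norm)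
      qed
      moreover have "e\<^sup>2 / 8 > 0" using \<open>e > 0\<close> by simp
      ultimately show "\<exists>d>0. \<forall>x\<in>T. \<forall>x'\<in>T.
          (\<forall>z\<in>T. - H z \<le> - H x + d \<and> - H z \<le> - H x' + d) \<longrightarrow> dist x x' < e"
        by blast
    qed
  qed blast
  then have Hmin: "H y0 \<le> H y" if "y \<in> T" for y using that by fastforce
  define x0 where "x0 = X y0"
  have x0: "x0 \<in> K" "\<And>z. z \<in> K \<Longrightarrow> J y0 z \<le> J y0 x0"
    using XK[OF y0] X[OF y0] unfolding x0_def by auto
  \<comment> \<open>First-order condition at \<open>y0\<close>: compare \<open>y0\<close> with \<open>Y n\<close>, a point of the segment from \<open>y0\<close> to \<open>y\<close>,
    at the maximizer \<open>X (Y n)\<close> belonging to \<open>Y n\<close>, which converges to \<open>x0\<close> by well-posedness.\<close>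
  have var: "(F x0 - y0) \<bullet> (y - y0) \<le> 0" if "y \<in> T" for y
  proof -
    define t where "t n = inverse (real (Suc n))" for n
    define Y where "Y n = y0 + t n *\<^sub>R (y - y0)" for n
    have t: "0 < t n" "t n \<le> 1" for n unfolding t_def by (simp_all add: inverse_le_1_iff)
    have t0: "t \<longlonglongrightarrow> 0" unfolding t_def by (rule LIMSEQ_inverse_real_of_nat)
    have YT: "Y n \<in> T" for n
      using convexD_alt[OF T(2) y0 that, of "t n"] t[of n] by (simp add: Y_def algebra_simps)
    have XY: "X (Y n) \<in> K" for n using XK[OF YT] .
    have "(\<lambda>n. X (Y n)) \<longlonglongrightarrow> x0"
    proof (rule well_posed_max_convergent[OF wpJ[OF y0] x0 XY])
      have low: "J y0 x0 - 2 * C * (t n * norm (y - y0)) \<le> J y0 (X (Y n))" for n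
      proof -
        have "norm (y0 - Y n) = t n * norm (y - y0)" "norm (Y n - y0) = t n * norm (y - y0)"
          using t(1)[of n] by (simp_all add: Y_def)
        then show ?thesis
          using Jlip[OF x0(1) y0 YT, of n] X[OF YT x0(1), of n] Jlip[OF XY YT y0, of n n] by simp
      qed
      have lowlim: "(\<lambda>n. J y0 x0 - 2 * C * (t n * norm (y - y0))) \<longlonglongrightarrow> J y0 x0 - 2 * C * (0 * norm (y - y0))"
        by (intro tendsto_intros t0)
      show "(\<lambda>n. J y0 (X (Y n))) \<longlonglongrightarrow> J y0 x0"
      proof (rule tendsto_sandwich[OF _ _ _ tendsto_const])
        show "(\<lambda>n. J y0 x0 - 2 * C * (t n * norm (y - y0))) \<longlonglongrightarrow> J y0 x0"
          using lowlim by simp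
      qed (simp_all add: low x0(2)[OF XY])
    qed
    then have "(\<lambda>n. F (X (Y n))) \<longlonglongrightarrow> F x0"
      by (rule continuous_on_tendsto_compose[OF F(1) _ x0(1)]) (simp add: XY)
    then have "(\<lambda>n. (F (X (Y n)) - y0) \<bullet> (y - y0)) \<longlonglongrightarrow> (F x0 - y0) \<bullet> (y - y0)"
      by (intro tendsto_intros)
    moreover have "(\<lambda>n. t n / 2 * (norm (y - y0))\<^sup>2) \<longlonglongrightarrow> 0 / 2 * (norm (y - y0))\<^sup>2"
      by (intro tendsto_intros t0) auto
    moreover have "(F (X (Y n)) - y0) \<bullet> (y - y0) \<le> t n / 2 * (norm (y - y0))\<^sup>2" for n
    proof -
      have "J y0 (X (Y n)) \<le> J (Y n) (X (Y n))"
        using Hmin[OF YT, of n] X[OF y0 XY, of n] unfolding H_def by linarith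
      then have "(norm (F (X (Y n)) - y0))\<^sup>2 \<le> (norm ((F (X (Y n)) - y0) - t n *\<^sub>R (y - y0)))\<^sup>2"
        by (simp add: J_def Y_def algebra_simps)
      also have "\<dots> = (norm (F (X (Y n)) - y0))\<^sup>2
          - t n * (2 * ((F (X (Y n)) - y0) \<bullet> (y - y0)) - t n * (norm (y - y0))\<^sup>2)"
        unfolding power2_norm_eq_inner
        by (simp only: inner_diff_left[of _ "_ *\<^sub>R _"] inner_diff_right[of _ _ "_ *\<^sub>R _"]
            inner_scaleR_left inner_scaleR_right) (simp add: inner_commute algebra_simps)
      finally have "t n * (2 * ((F (X (Y n)) - y0) \<bullet> (y - y0)) - t n * (norm (y - y0))\<^sup>2) \<le> 0"
        by simp
      then show ?thesis using t(1)[of n] by (simp add: mult_le_0_iff)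
    qed
    ultimately have "(F x0 - y0) \<bullet> (y - y0) \<le> 0 / 2 * (norm (y - y0))\<^sup>2"
      by (intro LIMSEQ_le) blast+
    then show ?thesis by simp
  qed
  have "norm (F x0 - y0) \<le> norm (F x0 - y)" if "y \<in> T" for y
  proof -
    have "(norm (F x0 - y))\<^sup>2 = (norm ((F x0 - y0) - (y - y0)))\<^sup>2" by simp
    also have "\<dots> = (norm (F x0 - y0))\<^sup>2 - 2 * ((F x0 - y0) \<bullet> (y - y0)) + (norm (y - y0))\<^sup>2"
      unfolding power2_norm_eq_inner inner_diff_left[of "F x0 - y0" "y - y0"]
        inner_diff_right[of _ "F x0 - y0" "y - y0"]
      by (simp add: inner_commute)
    finally have "(norm (F x0 - y0))\<^sup>2 \<le> (norm (F x0 - y))\<^sup>2"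
      using var[OF that] zero_le_power2[of "norm (y - y0)"] by linarith
    then show ?thesis by (rule power2_le_imp_le) simp
  qed
  with x0 y0 show thesis using that[of x0 y0] unfolding J_def by blast
qed


section \<open>Lipschitz maps\<close>

lemma bounded_lipschitz_image:
  assumes lip: "C-lipschitz_on S g" and "bounded S"
  shows "bounded (g ` S)"
proof (cases "S = {}")
  case False
  then obtain a where a: "a \<in> S" by blast
  obtain e where e: "\<And>x. x \<in> S \<Longrightarrow> dist a x \<le> e"
    using \<open>bounded S\<close> unfolding bounded_any_center[of S a] by blast
  have "dist (g a) (g x) \<le> C * e" if "x \<in> S" for x
    using lipschitz_onD[OF lip a that] mult_left_mono[OF e[OF that] lipschitz_on_nonneg[OF lip]]
    by linarith
  then show ?thesis unfolding bounded_def by blast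
qed simp

text \<open>The infimum defining the least Lipschitz constant is itself a Lipschitz constant.\<close>

lemma lipschitz_on_lipschitz_constant:
  assumes "C-lipschitz_on S g"
  shows "(lipschitz_constant g S)-lipschitz_on S g"
proof (rule lipschitz_onI)
  let ?A = "{C. C-lipschitz_on S g}"
  have ne: "?A \<noteq> {}" using assms by blast
  show "0 \<le> lipschitz_constant g S"
    unfolding lipschitz_constant_def using ne by (intro cInf_greatest) (auto dest: lipschitz_on_nonneg)
  fix x y assume xy: "x \<in> S" "y \<in> S"
  show "dist (g x) (g y) \<le> lipschitz_constant g S * dist x y"
  proof (cases "x = y")
    case False
    have "dist (g x) (g y) / dist x y \<le> lipschitz_constant g S"
      unfolding lipschitz_constant_def using ne
    proof (rule cInf_greatest)
      fix K assume "K \<in> ?A"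
      then show "dist (g x) (g y) / dist x y \<le> K"
        using lipschitz_onD[of K S g x y] xy False by (simp add: divide_le_eq)
    qed
    then show ?thesis using False by (simp add: divide_le_eq)
  qed simp
qed


section \<open>The saddle point on the sphere\<close>

theorem theorem5:
  fixes Y :: "'a::{real_inner, banach} set"
    and f :: "'a \<Rightarrow> 'a"
    and f' :: "'a \<Rightarrow> ('a \<Rightarrow>\<^sub>L 'a)"
    and \<rho> \<gamma> \<eta> \<theta> L :: real
    and \<sigma> :: ereal
  assumes "closed Y" and "bounded Y" and "convex Y"
    and "\<rho> > 0"
    and "\<And>x. x \<in> cball 0 \<rho> \<Longrightarrow>
      (f has_derivative blinfun_apply (f' x)) (at x within cball 0 \<rho>)"
    and "continuous_on (cball 0 \<rho>) f'"
    and "\<gamma>-lipschitz_on (cball 0 \<rho>) f'"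
    and "\<eta> = lipschitz_constant (\<lambda>x. x - f x) (cball 0 \<rho>)"
    and "\<theta> = (SUP x\<in>cball 0 \<rho>. norm (f' x))"
    and "L = 2 * (\<eta> + \<theta> + \<gamma> * (\<rho> + (SUP y\<in>Y. norm y)))"
    and "\<sigma> = (INF y\<in>Y. SUP u\<in>sphere 0 1. ereal \<bar>blinfun_apply (f' 0) u \<bullet> y - f 0 \<bullet> u\<bar>)"
    and "\<sigma> > 0"
  shows "\<forall>r::real. 0 < r \<and> ereal r \<le> min (ereal \<rho>) (\<sigma> / ereal L) \<longrightarrow>
    (\<forall>T. T \<noteq> {} \<and> closed T \<and> convex T \<and> T \<subseteq> Y \<longrightarrow>
      (\<exists>x'\<in>sphere 0 r. \<exists>y'\<in>T.
        (\<forall>x\<in>cball 0 r - {x'}.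
          (norm (x' - f x'))\<^sup>2 + (norm (f x - y'))\<^sup>2 - (norm (x - f x))\<^sup>2
            < (norm (f x' - y'))\<^sup>2) \<and>
        (norm (f x' - y'))\<^sup>2 = (infdist (f x') T)\<^sup>2))"
proof (intro allI impI)
  fix r :: real and T :: "'a set"
  assume r: "0 < r \<and> ereal r \<le> min (ereal \<rho>) (\<sigma> / ereal L)"
    and T: "T \<noteq> {} \<and> closed T \<and> convex T \<and> T \<subseteq> Y"
  note der = assms(5)
  have rpos: "r > 0" and r\<rho>: "r \<le> \<rho>" using r by simp_all
  define N where "N = (SUP y\<in>Y. norm y)"
  have bY: "bdd_above (norm ` Y)" using \<open>bounded Y\<close> by (simp add: bdd_above_norm)
  have N: "norm y \<le> N" if "y \<in> T" for y
    unfolding N_def using that T bY by (intro cSUP_upper) auto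
  have \<gamma>0: "\<gamma> \<ge> 0" using assms(7) by (rule lipschitz_on_nonneg)
  have "norm (f' x) \<le> norm (f' 0) + \<gamma> * \<rho>" if "x \<in> cball 0 \<rho>" for x
  proof -
    have "norm (f' x - f' 0) \<le> \<gamma> * norm x"
      using lipschitz_onD[OF assms(7) that, of 0] \<open>\<rho> > 0\<close> by (simp add: dist_norm)
    also have "\<dots> \<le> \<gamma> * \<rho>" using that \<gamma>0 by (intro mult_left_mono) auto
    finally show ?thesis using norm_triangle_sub[of "f' x" "f' 0"] by linarith
  qed
  then have "bdd_above ((\<lambda>x. norm (f' x)) ` cball 0 \<rho>)" by (rule bdd_aboveI2)
  then have \<theta>: "norm (f' x) \<le> \<theta>" if "x \<in> cball 0 \<rho>" for x
    unfolding assms(9) using that by (intro cSUP_upper)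
  have \<theta>0: "\<theta> \<ge> 0" using order_trans[OF norm_ge_zero \<theta>[of 0]] \<open>\<rho> > 0\<close> by simp
  have lipf: "\<theta>-lipschitz_on (cball 0 \<rho>) f"
  proof (rule bounded_derivative_imp_lipschitz[OF der convex_cball _ \<theta>0])
    fix x :: 'a assume "x \<in> cball 0 \<rho>"
    then show "onorm (blinfun_apply (f' x)) \<le> \<theta>" using \<theta> by (simp flip: norm_blinfun.rep_eq)
  qed
  have "(1 + \<theta>)-lipschitz_on (cball 0 \<rho>) (\<lambda>x. x - f x)"
    by (intro lipschitz_on_diff lipf) (simp add: lipschitz_on_def)
  then have lip\<eta>: "\<eta>-lipschitz_on (cball 0 \<rho>) (\<lambda>x. x - f x)"
    unfolding assms(8) by (rule lipschitz_on_lipschitz_constant)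
  have \<sigma>Y: "\<sigma> \<le> (SUP u\<in>sphere 0 1. ereal \<bar>blinfun_apply (f' 0) u \<bullet> y - f 0 \<bullet> u\<bar>)" if "y \<in> T" for y
    unfolding assms(11) using that T by (intro INF_lower) auto
  obtain y1 where y1: "y1 \<in> T" using T by blast
  \<comment> \<open>The space is nontrivial: otherwise the supremum over the empty unit sphere is \<open>-\<infinity>\<close>, contradicting \<open>\<sigma> > 0\<close>.\<close>
  obtain v :: 'a where v: "norm v = 1"
  proof (cases "sphere (0::'a) 1 = {}")
    case True
    then show thesis using \<sigma>Y[OF y1] \<open>\<sigma> > 0\<close> by (simp add: bot_ereal_def)
  next
    case False
    then show thesis using that by auto
  qed
  \<comment> \<open>The identity is the sum of \<open>x - f x\<close> and \<open>f x\<close>, so the two Lipschitz constants add up to at least \<open>1\<close>;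
    this makes \<open>L\<close> positive and lets the bound on \<open>r\<close> be cleared of its denominator.\<close>
  have "1 \<le> \<eta> + \<theta>"
  proof -
    define w where "w = \<rho> *\<^sub>R v"
    have w: "w \<in> cball 0 \<rho>" "norm w = \<rho>" using v \<open>\<rho> > 0\<close> by (simp_all add: w_def)
    have "norm (f w - f 0) \<le> \<theta> * \<rho>"
      using lipschitz_onD[OF lipf w(1), of 0] \<open>\<rho> > 0\<close> w by (simp add: dist_norm)
    moreover have "norm ((w - f w) - (0 - f 0)) \<le> \<eta> * \<rho>"
      using lipschitz_onD[OF lip\<eta> w(1), of 0] \<open>\<rho> > 0\<close> w by (simp add: dist_norm)
    moreover have "norm w \<le> norm ((w - f w) - (0 - f 0)) + norm (f w - f 0)"
      using norm_triangle_ineq[of "(w - f w) - (0 - f 0)" "f w - f 0"] by simp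
    ultimately have "\<rho> * 1 \<le> \<rho> * (\<eta> + \<theta>)" using w by (simp add: algebra_simps)
    then show ?thesis using \<open>\<rho> > 0\<close> by (simp only: mult_le_cancel_left_pos)
  qed
  moreover have "N \<ge> 0" using N[OF y1] norm_ge_zero[of y1] by linarith
  ultimately have Lpos: "L > 0"
    unfolding assms(10) N_def[symmetric] using \<gamma>0 \<open>\<rho> > 0\<close>
    by (smt (verit) mult_nonneg_nonneg)
  have "ereal (r * L) \<le> \<sigma>"
    using r Lpos by (simp add: ereal_le_divide_pos mult.commute)
  \<comment> \<open>The derivative at \<open>x\<close>, applied to \<open>h\<close>, of the function maximized for a given \<open>y\<close>.\<close>
  define D where "D y x h = 2 * ((f x - x) \<bullet> h + blinfun_apply (f' x) h \<bullet> (x - y))" for y x h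
  have sub: "cball 0 r \<subseteq> (cball 0 \<rho> :: 'a set)" using r\<rho> by auto
  have derJ: "((\<lambda>x. (norm (f x - y))\<^sup>2 - (norm (x - f x))\<^sup>2) has_derivative D y x) (at x within cball 0 r)"
    if "x \<in> cball 0 r" for x y
  proof -
    have "(f has_derivative blinfun_apply (f' x)) (at x within cball 0 r)"
      using has_derivative_subset[OF der sub] that sub by blast
    then show ?thesis
      unfolding D_def power2_norm_eq_inner
      by (auto intro!: derivative_eq_intros simp: fun_eq_iff inner_commute algebra_simps)
  qed
  have lipD: "\<bar>D y x h - D y x' h\<bar> \<le> L * norm (x - x') * norm h"
    if "y \<in> T" "x \<in> cball 0 r" "x' \<in> cball 0 r" for x x' y h
  proof -
    have x: "x \<in> cball 0 \<rho>" "x' \<in> cball 0 \<rho>" using that sub by auto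
    have eq: "D y x h - D y x' h = 2 * (- (((x - f x) - (x' - f x')) \<bullet> h)
        + blinfun_apply (f' x) h \<bullet> (x - x') + blinfun_apply (f' x - f' x') h \<bullet> (x' - y))"
      unfolding D_def by (simp add: blinfun.diff_left algebra_simps)
    have "\<bar>((x - f x) - (x' - f x')) \<bullet> h\<bar> \<le> norm ((x - f x) - (x' - f x')) * norm h"
      by (rule Cauchy_Schwarz_ineq2)
    also have "\<dots> \<le> \<eta> * norm (x - x') * norm h"
      using lipschitz_onD[OF lip\<eta> x] by (intro mult_right_mono) (auto simp: dist_norm)
    finally have 1: "\<bar>((x - f x) - (x' - f x')) \<bullet> h\<bar> \<le> \<eta> * norm (x - x') * norm h" .
    have "\<bar>blinfun_apply (f' x) h \<bullet> (x - x')\<bar> \<le> norm (blinfun_apply (f' x) h) * norm (x - x')"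
      by (rule Cauchy_Schwarz_ineq2)
    also have "\<dots> \<le> (\<theta> * norm h) * norm (x - x')"
      using norm_blinfun[of "f' x" h] mult_right_mono[OF \<theta>[OF x(1)] norm_ge_zero[of h]]
      by (intro mult_right_mono) auto
    finally have 2: "\<bar>blinfun_apply (f' x) h \<bullet> (x - x')\<bar> \<le> \<theta> * norm (x - x') * norm h"
      by (simp add: mult_ac)
    have "\<bar>blinfun_apply (f' x - f' x') h \<bullet> (x' - y)\<bar>
        \<le> norm (blinfun_apply (f' x - f' x') h) * norm (x' - y)"
      by (rule Cauchy_Schwarz_ineq2)
    also have "\<dots> \<le> (\<gamma> * norm (x - x') * norm h) * (\<rho> + N)"
    proof (rule mult_mono)
      have "norm (f' x - f' x') \<le> \<gamma> * norm (x - x')"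
        using lipschitz_onD[OF assms(7) x] by (simp add: dist_norm)
      then show "norm (blinfun_apply (f' x - f' x') h) \<le> \<gamma> * norm (x - x') * norm h"
        using norm_blinfun[of "f' x - f' x'" h] mult_right_mono[OF _ norm_ge_zero[of h]]
        by (meson order_trans)
      show "norm (x' - y) \<le> \<rho> + N"
        using norm_triangle_ineq4[of x' y] N[OF that(1)] x(2) by simp
    qed (use \<gamma>0 in auto)
    finally have 3: "\<bar>blinfun_apply (f' x - f' x') h \<bullet> (x' - y)\<bar>
        \<le> \<gamma> * (\<rho> + N) * norm (x - x') * norm h" by (simp add: mult_ac)
    have "L * norm (x - x') * norm h = 2 * (\<eta> * norm (x - x') * norm h
        + \<theta> * norm (x - x') * norm h + \<gamma> * (\<rho> + N) * norm (x - x') * norm h)"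
      unfolding assms(10) N_def by (simp add: algebra_simps)
    have sum3: "\<bar>2 * (- p + q + s)\<bar> \<le> 2 * (a + b + c)"
      if "\<bar>p\<bar> \<le> a" "\<bar>q\<bar> \<le> b" "\<bar>s\<bar> \<le> c" for p q s a b c :: real
      using that by (simp add: abs_le_iff)
    show ?thesis unfolding eq \<open>L * norm (x - x') * norm h = _\<close> by (rule sum3[OF 1 2 3])
  qed
  have steep: "\<exists>u. norm u = 1 \<and> 2 * L * r - e < D y 0 u" if "y \<in> T" "e > 0" for y e
  proof -
    have "ereal (r * L - e / 2) < ereal (r * L)" using that by simp
    also have "\<dots> \<le> \<sigma>" by fact
    also have "\<dots> \<le> (SUP u\<in>sphere 0 1. ereal \<bar>blinfun_apply (f' 0) u \<bullet> y - f 0 \<bullet> u\<bar>)"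
      using \<sigma>Y that by blast
    finally obtain u where u: "norm u = 1" "r * L - e / 2 < \<bar>blinfun_apply (f' 0) u \<bullet> y - f 0 \<bullet> u\<bar>"
      unfolding less_SUP_iff by auto
    have D0: "D y 0 w = - 2 * (blinfun_apply (f' 0) w \<bullet> y - f 0 \<bullet> w)" for w
      unfolding D_def by simp
    \<comment> \<open>The definition of \<open>\<sigma>\<close> involves an absolute value; replacing \<open>u\<close> by \<open>- u\<close> fixes the sign.\<close>
    have neg: "D y 0 (- u) = - D y 0 u" unfolding D0 by (simp add: blinfun.minus_right)
    have "\<bar>D y 0 u\<bar> = 2 * \<bar>blinfun_apply (f' 0) u \<bullet> y - f 0 \<bullet> u\<bar>"
      unfolding D0 by (subst abs_mult) simp
    moreover have "2 * L * r - e < 2 * A" if "r * L - e / 2 < A" for A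
      using that by (simp add: field_simps)
    ultimately have "2 * L * r - e < \<bar>D y 0 u\<bar>"
      using u(2) by presburger
    then have "2 * L * r - e < D y 0 u \<or> 2 * L * r - e < D y 0 (- u)"
      unfolding neg by (simp add: abs_if split: if_splits)
    then show ?thesis using u(1) norm_minus_cancel[of u] by metis
  qed
  have wp: "well_posed_max (\<lambda>x. (norm (f x - y))\<^sup>2 - (norm (x - f x))\<^sup>2) (cball 0 r)" if "y \<in> T" for y
    by (rule steep_well_posed_max[where D = "D y" and M = L,
          OF derJ lipD[OF that] steep[OF that] Lpos rpos])
  have lipfr: "\<theta>-lipschitz_on (cball 0 r) f"
    using lipf sub by (rule lipschitz_on_subset)
  have lip\<eta>r: "\<eta>-lipschitz_on (cball 0 r) (\<lambda>x. x - f x)"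
    using lip\<eta> sub by (rule lipschitz_on_subset)
  obtain x0 y0 where x0: "x0 \<in> cball 0 r" and y0: "y0 \<in> T"
    and max: "\<And>x. x \<in> cball 0 r \<Longrightarrow>
      (norm (f x - y0))\<^sup>2 - (norm (x - f x))\<^sup>2 \<le> (norm (f x0 - y0))\<^sup>2 - (norm (x0 - f x0))\<^sup>2"
    and near: "\<And>y. y \<in> T \<Longrightarrow> norm (f x0 - y0) \<le> norm (f x0 - y)"
  proof (rule well_posed_saddle_point[OF _ _ _ _ _ _ _ _ _ _ wp])
    show "complete (cball 0 r :: 'a set)" by (simp add: complete_eq_closed)
    show "cball 0 r \<noteq> ({} :: 'a set)" using rpos by simp
    show "continuous_on (cball 0 r) f" using lipfr by (rule lipschitz_on_continuous_on)
    show "bounded (f ` cball 0 r)"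
      using lipfr by (rule bounded_lipschitz_image) simp
    show "continuous_on (cball 0 r) (\<lambda>x. (norm (x - f x))\<^sup>2)"
      by (intro continuous_intros lipschitz_on_continuous_on[OF lipfr])
    have "bounded ((\<lambda>x. x - f x) ` cball 0 r)"
      using lip\<eta>r by (rule bounded_lipschitz_image) simp
    then obtain b where "\<And>x. x \<in> cball 0 r \<Longrightarrow> norm (x - f x) \<le> b"
      unfolding bounded_iff by blast
    then have "norm ((norm (x - f x))\<^sup>2) \<le> b\<^sup>2" if "x \<in> cball 0 r" for x
      using that by (simp add: power_mono)
    then show "bounded ((\<lambda>x. (norm (x - f x))\<^sup>2) ` cball 0 r)"
      unfolding bounded_iff by blast
    show "closed T" "convex T" "T \<noteq> {}" using T by auto
    show "bounded T" using T \<open>bounded Y\<close> bounded_subset by blast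
  qed (assumption | rule that)+
  show "\<exists>x'\<in>sphere 0 r. \<exists>y'\<in>T.
        (\<forall>x\<in>cball 0 r - {x'}.
          (norm (x' - f x'))\<^sup>2 + (norm (f x - y'))\<^sup>2 - (norm (x - f x))\<^sup>2
            < (norm (f x' - y'))\<^sup>2) \<and>
        (norm (f x' - y'))\<^sup>2 = (infdist (f x') T)\<^sup>2"
  proof (intro bexI conjI ballI)
    show "x0 \<in> sphere 0 r"
      by (rule steep_maximum_on_sphere[where D = "D y0" and M = L,
            OF derJ lipD[OF y0] steep[OF y0] Lpos rpos x0 max])
    show "y0 \<in> T" by fact
    fix x assume "x \<in> cball 0 r - {x0}"
    then have "(norm (f x - y0))\<^sup>2 - (norm (x - f x))\<^sup>2 < (norm (f x0 - y0))\<^sup>2 - (norm (x0 - f x0))\<^sup>2"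
      using well_posed_max_strict[OF wp[OF y0] x0 max] by blast
    then show "(norm (x0 - f x0))\<^sup>2 + (norm (f x - y0))\<^sup>2 - (norm (x - f x))\<^sup>2
            < (norm (f x0 - y0))\<^sup>2" by linarith
  next
    have "infdist (f x0) T = norm (f x0 - y0)"
    proof (rule antisym)
      show "infdist (f x0) T \<le> norm (f x0 - y0)"
        using infdist_le[OF y0, of "f x0"] by (simp add: dist_norm)
      show "norm (f x0 - y0) \<le> infdist (f x0) T"
        using near T by (subst infdist_notempty) (auto intro!: cINF_greatest simp: dist_norm)
    qed
    then show "(norm (f x0 - y0))\<^sup>2 = (infdist (f x0) T)\<^sup>2" by simp
  qed
qed

end
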